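(* Let $m\geq1$ and $k=\lceil m/2\rceil$. Inside the $m\times\infty$ table, we have $$\mathcal{M}_m(k-a)\,\mathcal{I}_m(n)=2\bigl(\mathcal{M}'(k-1)+(\mathcal{M}_m(0)-1)\mathcal{M}'(k-2)\bigr)\mathcal{C}(n,a)$$ for all $a=1,\ldots,k$ and $n\geq1$.
   Context: Table: for an integer $m\geq1$, define $\mathcal{C}(x,y)=\mathcal{C}_m(x,y)$ for $x\geq1$, $1\leq y\leq m$, as the number of lattice paths (sequences of cells of the $m\times\infty$ table with steps in $\{(1,-1),(1,0),(1,1)\}$, first coordinate being the column) from any cell of the first column to the cell $(x,y)$. Equivalently, $\mathcal{C}(1,y)=1$ and $\mathcal{C}(x+1,y)=\mathcal{C}(x,y-1)+\mathcal{C}(x,y)+\mathcal{C}(x,y+1)$, with $\mathcal{C}(x,0)=\mathcal{C}(x,m+1)=0$. The $n$th column sum is $\mathcal{I}_m(n)=\mathcal{C}(n,1)+\cdots+\mathcal{C}(n,m)$. Multipliers: $\Delta$ is the difference operator, $\Delta a(n)=a(n+1)-a(n)$ for a sequence $\{a(n)\}$. $\mathcal{M}_m(n)$, $n\geq0$, are polynomials in $\Delta$ defined by $\mathcal{M}_m(0)=2$ if $m$ is odd and $\mathcal{M}_m(0)=1$ if $m$ is even, $\mathcal{M}_m(1)=\Delta-2+\mathcal{M}_m(0)$, and $\mathcal{M}_m(n+2)=\Delta\mathcal{M}_m(n+1)-\mathcal{M}_m(n)$ for all $n\geq0$. $\mathcal{M}'(n)$ are the polynomials in $\Delta$ defined by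 $\mathcal{M}'(0)=1$, $\mathcal{M}'(1)=\Delta$, $\mathcal{M}'(n+2)=\Delta\mathcal{M}'(n+1)-\mathcal{M}'(n)$ for $n\geq0$, extended by $\mathcal{M}'(-1)=0$. Polynomials in $\Delta$ act on $\mathcal{C}(n,i)$ with respect to the variable $n$ (with $i$ fixed), i.e. $\Delta\mathcal{C}(n,i)=\mathcal{C}(n+1,i)-\mathcal{C}(n,i)$, and on $\mathcal{I}_m(n)$ with respect to $n$. *)

theory Defs
  imports Complex_Main "HOL-Computational_Algebra.Polynomial"
begin

text \<open>A cell is a pair (column, row).\<close>

definition table :: "nat \<Rightarrow> (int \<times> int) set" where
  "table m = {(x, y). 1 \<le> x \<and> 1 \<le> y \<and> y \<le> int m}"

definition steps :: "(int \<times> int) set" where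
  "steps = {(1, -1), (1, 0), (1, 1)}"

definition lattice_path :: "nat \<Rightarrow> (int \<times> int) list \<Rightarrow> bool" where
  "lattice_path m p \<longleftrightarrow> p \<noteq> [] \<and> set p \<subseteq> table m \<and>
     successively (\<lambda>(x, y) (x', y'). (x' - x, y' - y) \<in> steps) p"

definition cell_count :: "nat \<Rightarrow> nat \<Rightarrow> nat \<Rightarrow> int" where
  "cell_count m x y =
     int (card {p. lattice_path m p \<and> fst (hd p) = 1 \<and> last p = (int x, int y)})"

definition column_sum :: "nat \<Rightarrow> nat \<Rightarrow> int" where
  "column_sum m n = (\<Sum>y = 1..m. cell_count m n y)"

definition difference :: "(nat \<Rightarrow> int) \<Rightarrow> nat \<Rightarrow> int" where
  "difference f n = f (n + 1) - f n"

text \<open>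
  Polynomials in the difference operator are represented by integer polynomials,
  the indeterminate \<open>[:0, 1:]\<close> standing for \<open>\<Delta>\<close>; they act on integer sequences by
  substituting \<^const>\<open>difference\<close> for the indeterminate.
\<close>

definition act :: "int poly \<Rightarrow> (nat \<Rightarrow> int) \<Rightarrow> nat \<Rightarrow> int" where
  "act p f n = (\<Sum>i\<le>degree p. coeff p i * (difference ^^ i) f n)"

abbreviation Delta :: "int poly" where
  "Delta \<equiv> [:0, 1:]"

fun multiplier :: "nat \<Rightarrow> nat \<Rightarrow> int poly" where
  "multiplier m 0 = (if odd m then 2 else 1)"
| "multiplier m (Suc 0) = Delta - 2 + multiplier m 0"
| "multiplier m (Suc (Suc n)) = Delta * multiplier m (Suc n) - multiplier m n"

fun multiplier'_nat :: "nat \<Rightarrow> int poly" where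
  "multiplier'_nat 0 = 1"
| "multiplier'_nat (Suc 0) = Delta"
| "multiplier'_nat (Suc (Suc n)) = Delta * multiplier'_nat (Suc n) - multiplier'_nat n"

text \<open>Of the negative indices only \<open>-1\<close> is meaningful, where the value is 0.\<close>

definition multiplier' :: "int \<Rightarrow> int poly" where
  "multiplier' i = (if i < 0 then 0 else multiplier'_nat (nat i))"

end

theory Submission
  imports Defs
begin

text \<open>
  Write \<open>c y\<close> for the sequence of path counts in row \<open>y\<close>, \<open>s\<close> for \<open>multiplier m 0\<close>, and
  \<open>F p\<close> for \<open>multiplier' p + (s - 1) * multiplier' (p - 1)\<close>. Removing the last cell of a path
  gives \<open>\<Delta> (c y) = c (y - 1) + c (y + 1)\<close> with \<open>c 0 = c (m + 1) = 0\<close>, and the table is symmetric,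
  \<open>c (m + 1 - y) = c y\<close>.

  The polynomials \<open>F p\<close> and \<open>multiplier m j\<close> both satisfy the recurrence
  \<open>X (i + 2) = \<Delta> * X (i + 1) - X i\<close>, so it suffices to find sequences satisfying the same
  recurrence. With \<open>k = \<lceil>m / 2\<rceil>\<close>, the sums of \<open>c y\<close> over the centred blocks
  \<open>k - p \<le> y \<le> m + 1 - k + p\<close> satisfy it, which gives that \<open>2 * F p\<close> applied to \<open>c k\<close> is \<open>s\<close> times
  the block sum (\<open>act_central_multiplier\<close>). For \<open>p = k - 1\<close> the block is the whole column, and the
  result is the theorem for \<open>a = k\<close>. The sequences \<open>c (k - j)\<close>, \<open>j = 0, 1, \<dots>\<close>, satisfy
  the recurrence too, whence the theorem for smaller \<open>a\<close>, once the case \<open>a = k - 1\<close> has been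
  obtained from the symmetry.
\<close>

section \<open>Polynomials acting on sequences\<close>

lemma act_0 [simp]: "act 0 f n = 0"
  by (simp add: act_def)

lemma act_eq_sum_atMost:
  assumes "degree p \<le> d"
  shows "act p f n = (\<Sum>i\<le>d. coeff p i * (difference ^^ i) f n)"
  unfolding act_def using assms
  by (intro sum.mono_neutral_left) (auto simp: coeff_eq_0)

lemma act_pCons: "act (pCons a p) f n = a * f n + act p (difference f) n"
proof -
  have "act (pCons a p) f n
      = (\<Sum>i\<le>Suc (degree p). coeff (pCons a p) i * (difference ^^ i) f n)"
    by (intro act_eq_sum_atMost degree_pCons_le)
  also have "\<dots> = a * f n + act p (difference f) n"
    by (simp only: sum.atMost_Suc_shift) (simp add: act_def funpow_swap1)
  finally show ?thesis .
qed

lemma act_add: "act (p + q) f n = act p f n + act q f n"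
proof -
  let ?d = "max (degree p) (degree q)"
  have "act (p + q) f n = (\<Sum>i\<le>?d. coeff (p + q) i * (difference ^^ i) f n)"
    by (intro act_eq_sum_atMost degree_add_le_max)
  moreover have "act p f n = (\<Sum>i\<le>?d. coeff p i * (difference ^^ i) f n)"
    and "act q f n = (\<Sum>i\<le>?d. coeff q i * (difference ^^ i) f n)"
    by (intro act_eq_sum_atMost; simp)+
  ultimately show ?thesis
    by (simp add: sum.distrib algebra_simps)
qed

lemma act_smult: "act (smult a p) f n = a * act p f n"
proof -
  have "act (smult a p) f n = (\<Sum>i\<le>degree p. coeff (smult a p) i * (difference ^^ i) f n)"
    by (intro act_eq_sum_atMost degree_smult_le)
  then show ?thesis
    by (simp add: act_def sum_distrib_left mult.assoc)
qed

lemma act_diff: "act (p - q) f n = act p f n - act q f n"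
  using act_add[of "p - q" q f n] by simp

lemma act_1 [simp]: "act 1 f n = f n"
  by (simp add: one_pCons act_pCons)

lemma act_numeral [simp]: "act (numeral w) f n = numeral w * f n"
  by (simp add: numeral_poly act_pCons)

lemma act_Delta [simp]: "act Delta f n = difference f n"
  by (simp add: act_pCons)

lemma difference_add: "difference (\<lambda>n. f n + g n) = (\<lambda>n. difference f n + difference g n)"
  by (simp add: difference_def fun_eq_iff)

lemma difference_cmult: "difference (\<lambda>n. c * f n) = (\<lambda>n. c * difference f n)"
  by (simp add: difference_def fun_eq_iff algebra_simps)

lemma difference_sum: "difference (\<lambda>n. \<Sum>y\<in>A. f y n) = (\<lambda>n. \<Sum>y\<in>A. difference (f y) n)"
  by (simp add: difference_def fun_eq_iff sum_subtractf)

lemma act_plus_right: "act p (\<lambda>n. f n + g n) n = act p f n + act p g n"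
  by (induction p arbitrary: f g) (simp_all add: act_pCons difference_add algebra_simps)

lemma act_difference: "act p (difference f) = difference (act p f)"
proof
  show "act p (difference f) n = difference (act p f) n" for n
    by (induction p arbitrary: f) (simp_all add: act_pCons difference_def algebra_simps)
qed

lemma act_mult: "act (p * q) f n = act p (act q f) n"
proof (induction p arbitrary: f)
  case (pCons a p)
  have "act (pCons a p * q) f n = a * act q f n + act (p * q) (difference f) n"
    by (simp add: mult_pCons_left act_add act_smult act_pCons)
  with pCons.IH[of "difference f"] show ?case
    by (simp add: act_pCons act_difference[of q])
qed simp

lemma act_Suc_shift: "act p f (Suc n) = act p (\<lambda>j. f (Suc j)) n"
proof (induction p arbitrary: f)
  case (pCons a p)
  have "difference (\<lambda>j. f (Suc j)) = (\<lambda>j. difference f (Suc j))"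
    by (simp add: difference_def fun_eq_iff)
  with pCons.IH[of "difference f"] show ?case
    by (simp add: act_pCons)
qed simp

section \<open>The recurrence and the symmetry of the path counts\<close>

text \<open>The paths from the first column to the cell \<open>(x, y)\<close>.\<close>

definition paths_to :: "nat \<Rightarrow> nat \<Rightarrow> nat \<Rightarrow> (int \<times> int) list set" where
  "paths_to m x y = {p. lattice_path m p \<and> fst (hd p) = 1 \<and> last p = (int x, int y)}"

lemma cell_count_eq_card: "cell_count m x y = int (card (paths_to m x y))"
  by (simp add: cell_count_def paths_to_def)

lemma paths_to_outside:
  assumes "x = 0 \<or> y = 0 \<or> y > m"
  shows "paths_to m x y = {}"
proof -
  have False if "p \<in> paths_to m x y" for p
  proof -
    from that have "last p \<in> table m" and "last p = (int x, int y)"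
      using last_in_set[of p] by (auto simp: paths_to_def lattice_path_def simp del: last_in_set)
    with assms show False by (auto simp: table_def)
  qed
  then show ?thesis by blast
qed

lemma lattice_path_snoc:
  "lattice_path m (q @ [z]) \<longleftrightarrow> z \<in> table m \<and> (q = [] \<or> lattice_path m q
     \<and> (fst z - fst (last q), snd z - snd (last q)) \<in> steps)"
  by (auto simp: lattice_path_def successively_append_iff split: prod.splits)

lemma paths_to_first_column:
  assumes "1 \<le> y" "y \<le> m"
  shows "paths_to m 1 y = {[(1, int y)]}"
proof (intro equalityI subsetI)
  fix p :: "(int \<times> int) list" assume p: "p \<in> paths_to m 1 y"
  then obtain q where q: "p = q @ [(1, int y)]"
    by (cases p rule: rev_cases) (auto simp: paths_to_def lattice_path_def)
  have "q = []"
  proof (rule ccontr)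
    assume "q \<noteq> []"
    with p q have "lattice_path m q" "1 - fst (last q) = 1"
      by (auto simp: paths_to_def lattice_path_snoc steps_def)
    then have "last q \<in> table m" "fst (last q) = 0"
      using \<open>q \<noteq> []\<close> by (auto simp: lattice_path_def)
    then show False by (auto simp: table_def)
  qed
  with q show "p \<in> {[(1, int y)]}" by simp
next
  fix p :: "(int \<times> int) list" assume "p \<in> {[(1, int y)]}"
  with assms show "p \<in> paths_to m 1 y"
    by (auto simp: paths_to_def lattice_path_def table_def)
qed

lemma paths_to_Suc:
  assumes "1 \<le> x" "1 \<le> y" "y \<le> m"
  shows "paths_to m (Suc x) y = (\<lambda>q. q @ [(int x + 1, int y)]) `
    (paths_to m x (y - 1) \<union> paths_to m x y \<union> paths_to m x (y + 1))" (is "_ = ?snoc ` ?Q")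
proof (intro equalityI subsetI)
  fix p :: "(int \<times> int) list" assume p: "p \<in> paths_to m (Suc x) y"
  then obtain q where q: "p = q @ [(int x + 1, int y)]"
    by (cases p rule: rev_cases) (auto simp: paths_to_def lattice_path_def)
  with p assms(1) have "q \<noteq> []"
    by (auto simp: paths_to_def)
  with p q have lq: "lattice_path m q" and hq: "fst (hd q) = 1"
    and st: "(int x + 1 - fst (last q), int y - snd (last q)) \<in> steps"
    by (auto simp: paths_to_def lattice_path_snoc)
  obtain u v where uv: "last q = (u, v)" by fastforce
  from st uv have "u = int x" and "v = int y - 1 \<or> v = int y \<or> v = int y + 1"
    by (auto simp: steps_def)
  then have "v = int (y - 1) \<or> v = int y \<or> v = int (y + 1)"
    using assms(2) by auto
  with lq hq uv \<open>u = int x\<close> have "q \<in> ?Q"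
    by (auto simp: paths_to_def)
  with q show "p \<in> ?snoc ` ?Q" by blast
next
  fix p :: "(int \<times> int) list" assume "p \<in> ?snoc ` ?Q"
  then obtain q where p: "p = ?snoc q" and q: "q \<in> ?Q" by blast
  from q have "q \<noteq> []" by (auto simp: paths_to_def lattice_path_def)
  with p q assms show "p \<in> paths_to m (Suc x) y"
    by (auto simp: paths_to_def lattice_path_snoc steps_def table_def)
qed

lemma finite_paths_to: "finite (paths_to m x y)"
proof (induction x arbitrary: y)
  case 0
  then show ?case by (simp add: paths_to_outside)
next
  case (Suc x)
  show ?case
  proof (cases "y = 0 \<or> y > m")
    case True
    then show ?thesis by (simp add: paths_to_outside)
  next
    case False
    with Suc show ?thesis
      by (cases "x = 0") (simp_all add: paths_to_first_column[unfolded One_nat_def] paths_to_Suc)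
  qed
qed

lemma cell_count_outside: "y = 0 \<or> y > m \<Longrightarrow> cell_count m x y = 0"
  by (simp add: cell_count_eq_card paths_to_outside)

lemma cell_count_first_column: "1 \<le> y \<Longrightarrow> y \<le> m \<Longrightarrow> cell_count m 1 y = 1"
  by (simp only: cell_count_eq_card paths_to_first_column) simp

lemma cell_count_Suc:
  assumes "1 \<le> x" "1 \<le> y" "y \<le> m"
  shows "cell_count m (Suc x) y
    = cell_count m x (y - 1) + cell_count m x y + cell_count m x (y + 1)"
proof -
  have disj: "paths_to m x i \<inter> paths_to m x j = {}" if "i \<noteq> j" for i j
    using that by (auto simp: paths_to_def)
  have "card (paths_to m (Suc x) y)
      = card (paths_to m x (y - 1) \<union> paths_to m x y \<union> paths_to m x (y + 1))"
    by (simp only: paths_to_Suc[OF assms]) (intro card_image inj_onI, simp)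
  also have "\<dots> = card (paths_to m x (y - 1)) + card (paths_to m x y)
      + card (paths_to m x (y + 1))"
    using assms(2)
    by (subst card_Un_disjoint card_Un_disjoint; simp add: finite_paths_to disj Int_Un_distrib2)+
  finally show ?thesis by (simp add: cell_count_eq_card)
qed

text \<open>
  The counts in row \<open>y\<close> as a sequence. It starts with the first column, because the recurrence
  does not hold from the empty column 0 to column 1.
\<close>

definition row :: "nat \<Rightarrow> nat \<Rightarrow> nat \<Rightarrow> int" where
  "row m y n = cell_count m (Suc n) y"

lemma row_0 [simp]: "row m 0 n = 0"
  by (simp add: row_def cell_count_outside)

lemma difference_row:
  assumes "1 \<le> y" "y \<le> m"
  shows "difference (row m y) = (\<lambda>n. row m (y - 1) n + row m (y + 1) n)"
  using assms cell_count_Suc[OF _ assms] by (simp add: fun_eq_iff difference_def row_def)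

lemma row_reflect:
  assumes "y \<le> m + 1"
  shows "row m (m + 1 - y) n = row m y n"
  using assms
proof (induction n arbitrary: y)
  case 0
  consider "y = 0" | "y = m + 1" | "1 \<le> y" "y \<le> m"
    using 0 by linarith
  then show ?case
  proof cases
    case 3
    then show ?thesis
      by (simp add: row_def cell_count_first_column[unfolded One_nat_def])
  qed (simp_all add: row_def cell_count_outside)
next
  case (Suc n)
  consider "y = 0" | "y = m + 1" | "1 \<le> y" "y \<le> m"
    using Suc.prems by linarith
  then show ?case
  proof cases
    case 3
    have rec: "row m z (Suc n) = row m (z - 1) n + row m z n + row m (z + 1) n"
      if "1 \<le> z" "z \<le> m" for z
      using cell_count_Suc[of "Suc n" z m] that by (simp add: row_def)
    have "m + 1 - y - 1 = m + 1 - (y + 1)" "m + 1 - y + 1 = m + 1 - (y - 1)"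
      using 3 by auto
    then show ?thesis
      using 3 Suc.IH[of "y - 1"] Suc.IH[of y] Suc.IH[of "y + 1"] rec[of y] rec[of "m + 1 - y"]
      by simp
  qed (simp_all add: row_def cell_count_outside)
qed

section \<open>Applying a multiplier to the middle row\<close>

lemma multiplier'_rec:
  assumes "i \<ge> -1"
  shows "multiplier' (i + 2) = Delta * multiplier' (i + 1) - multiplier' i"
proof (cases "i = -1")
  case False
  with assms have "nat (i + 2) = Suc (Suc (nat i))" "nat (i + 1) = Suc (nat i)" "i \<ge> 0"
    by auto
  then show ?thesis by (simp add: multiplier'_def)
qed (simp add: multiplier'_def)

text \<open>Half of the polynomial on the right-hand side of the theorem, with \<open>k - 1\<close> replaced by \<open>p\<close>.\<close>

definition central_multiplier :: "nat \<Rightarrow> nat \<Rightarrow> int poly" where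
  "central_multiplier m p
    = multiplier' (int p) + (multiplier m 0 - 1) * multiplier' (int p - 1)"

lemma central_multiplier_0: "central_multiplier m 0 = 1"
  by (simp add: central_multiplier_def multiplier'_def)

lemma central_multiplier_1: "central_multiplier m 1 = Delta + multiplier m 0 - 1"
  by (simp add: central_multiplier_def multiplier'_def)

lemma central_multiplier_Suc_Suc:
  "central_multiplier m (Suc (Suc p))
    = Delta * central_multiplier m (Suc p) - central_multiplier m p"
proof -
  have "multiplier' (int (Suc (Suc p))) = Delta * multiplier' (int (Suc p)) - multiplier' (int p)"
    and "multiplier' (int (Suc (Suc p)) - 1)
      = Delta * multiplier' (int (Suc p) - 1) - multiplier' (int p - 1)"
    using multiplier'_rec[of "int p"] multiplier'_rec[of "int p - 1"] by (simp_all add: add.commute)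
  then show ?thesis
    unfolding central_multiplier_def by algebra
qed

lemma sum_neighbours:
  fixes f :: "nat \<Rightarrow> 'a::comm_monoid_add"
  assumes "Suc u \<le> v"
  shows "(\<Sum>y = Suc u..Suc v. f (y - 1) + f (y + 1))
    = (\<Sum>y = u..Suc (Suc v). f y) + (\<Sum>y = Suc (Suc u)..v. f y)"
proof -
  have "(\<Sum>y = Suc u..Suc v. f (y - 1)) = sum f {u..v}"
    by (simp only: sum.shift_bounds_cl_Suc_ivl) simp
  moreover have "(\<Sum>y = Suc u..Suc v. f (y + 1)) = sum f {Suc (Suc u)..Suc (Suc v)}"
    by (simp add: sum.shift_bounds_cl_Suc_ivl del: sum.cl_ivl_Suc)
  ultimately show ?thesis
    using assms by (simp add: sum.distrib add_ac)
qed

text \<open>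
  In both parities of \<open>m\<close>, the block \<open>{k - p..m + 1 - k + p}\<close> is symmetric about the middle of
  the column. The block with \<open>p = 0\<close> consists of the single middle row if \<open>m\<close> is odd and of two
  equal rows if \<open>m\<close> is even; in either case \<open>multiplier m 0\<close> times its sum is twice row \<open>k\<close>.
  The sums over these blocks satisfy the recurrence of the multipliers by \<open>sum_neighbours\<close>.
\<close>

lemma act_central_multiplier:
  assumes k: "m = 2 * k \<or> m + 1 = 2 * k" and "p < k"
  shows "2 * act (central_multiplier m p) (row m k) n
    = (if odd m then 2 else 1) * (\<Sum>y = k - p..m + 1 - k + p. row m y n)"
  using \<open>p < k\<close>
proof (induction p arbitrary: n rule: induct_nat_012)
  case 0
  from k show ?case
  proof
    assume m: "m = 2 * k"
    then show ?thesis using row_reflect[of k m n]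
      by (simp add: central_multiplier_0 Suc_diff_le)
  next
    assume m: "m + 1 = 2 * k"
    then have "odd m" by presburger
    with m show ?thesis by (simp add: central_multiplier_0)
  qed
next
  case 1
  then have k': "1 \<le> k" "k \<le> m" using k by auto
  then obtain l where l: "k = Suc l" by (cases k) auto
  have r: "row m (m + 1 - l) n = row m l n" "row m (m + 1 - k) n = row m k n"
    using row_reflect[of l m n] row_reflect[of k m n] k' l by auto
  from k show ?case
  proof
    assume m: "m = 2 * k"
    then have "m + 1 - l = l + 3" "m + 1 - k = l + 2"
      using l by auto
    moreover have "even m" using m by simp
    ultimately show ?thesis
      using l r k' central_multiplier_1[of m]
      by (simp add: difference_row numeral_eq_Suc)
  next
    assume m: "m + 1 = 2 * k"
    then have "odd m" by presburger
    have "m + 1 - l = l + 2" "m + 1 - k = l + 1"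
      using l m by auto
    with \<open>odd m\<close> show ?thesis
      using l r k' central_multiplier_1[of m]
      by (simp add: act_add act_diff difference_row numeral_eq_Suc)
  qed
next
  case (ge2 p)
  let ?s = "if odd m then 2 else 1 :: int"
  let ?S = "\<lambda>p n. \<Sum>y = k - p..m + 1 - k + p. row m y n"
  define u where "u = k - Suc (Suc p)"
  define v where "v = m + 1 - k + p"
  have u: "k - Suc p = Suc u" "k - p = Suc (Suc u)" and v: "Suc v \<le> m" "Suc u \<le> v"
    using ge2(3) k by (auto simp: u_def v_def)
  have IH1: "2 * act (central_multiplier m (Suc p)) (row m k) j = ?s * ?S (Suc p) j" for j
    using ge2 by simp
  have IH0: "2 * act (central_multiplier m p) (row m k) n = ?s * ?S p n"
    using ge2 by simp
  have "difference (?S (Suc p)) n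
      = (\<Sum>y = Suc u..Suc v. row m (y - 1) n + row m (y + 1) n)"
    unfolding difference_sum u v_def add_Suc_right
    using v by (intro sum.cong) (auto simp: difference_row v_def)
  also have "\<dots> = ?S (Suc (Suc p)) n + ?S p n"
    using sum_neighbours[OF v(2), of "\<lambda>y. row m y n"] by (simp only: u u_def v_def add_Suc_right)
  finally have dS: "difference (?S (Suc p)) n = ?S (Suc (Suc p)) n + ?S p n" .
  have "2 * act (central_multiplier m (Suc (Suc p))) (row m k) n
      = difference (\<lambda>j. 2 * act (central_multiplier m (Suc p)) (row m k) j) n
        - 2 * act (central_multiplier m p) (row m k) n"
    unfolding central_multiplier_Suc_Suc difference_cmult by (simp only: act_diff act_mult act_Delta)
      (simp add: algebra_simps)
  also have "\<dots> = ?s * difference (?S (Suc p)) n - ?s * ?S p n"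
    by (simp only: IH1 IH0 difference_cmult)
  also have "\<dots> = ?s * ?S (Suc (Suc p)) n"
    by (simp only: dS) (simp add: algebra_simps)
  finally show ?case .
qed

section \<open>Descending from the middle row\<close>

text \<open>
  The theorem for the row \<open>a = k - j\<close>. The start \<open>j = 0\<close> is \<open>act_central_multiplier\<close> for the whole
  column. For \<open>j = 1\<close>, the row \<open>k + 1\<close> that occurs in the difference of row \<open>k\<close> is the mirror image
  of row \<open>k\<close> if \<open>m\<close> is even and of row \<open>k - 1\<close> if \<open>m\<close> is odd; this accounts for the parity in
  the definition of \<open>multiplier m 1\<close>.
\<close>

lemma act_multiplier_column_sum:
  fixes m k j n :: nat
  defines "I \<equiv> \<lambda>n. column_sum m (Suc n)"
  assumes k: "m = 2 * k \<or> m + 1 = 2 * k" and "j < k"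
  shows "act (multiplier m j) I n = 2 * act (central_multiplier m (k - 1)) (row m (k - j)) n"
  using \<open>j < k\<close>
proof (induction j arbitrary: n rule: induct_nat_012)
  case 0
  have "m + 1 - k + (k - 1) = m" "k - (k - 1) = 1"
    using 0 k by auto
  with 0 act_central_multiplier[OF k, of "k - 1" n] show ?case
    by (simp add: I_def column_sum_def row_def[symmetric])
next
  case 1
  let ?P = "act (central_multiplier m (k - 1))"
  have k': "1 \<le> k" "k \<le> m" using k 1 by auto
  have "m + 1 - k + (k - 1) = m" "k - (k - 1) = 1"
    using k' by auto
  then have mid: "2 * ?P (row m k) i = (if odd m then 2 else 1) * I i" for i
    using act_central_multiplier[OF k, of "k - 1" i] k'
    by (simp add: I_def column_sum_def row_def)
  have "difference (\<lambda>i. 2 * ?P (row m k) i) n = 2 * ?P (difference (row m k)) n"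
    by (simp add: difference_cmult act_difference)
  also have "\<dots> = 2 * ?P (row m (k - 1)) n + 2 * ?P (row m (k + 1)) n"
    using k' by (simp add: difference_row act_plus_right algebra_simps)
  finally have step: "(if odd m then 2 else 1) * difference I n
      = 2 * ?P (row m (k - 1)) n + 2 * ?P (row m (k + 1)) n"
    by (simp only: mid difference_cmult)
  from k show ?case
  proof
    assume m: "m = 2 * k"
    then have "row m (k + 1) = row m k"
      using row_reflect[of k m] by (simp add: fun_eq_iff mult_2 Suc_diff_le)
    with step mid[of n] m show ?thesis
      by (simp add: act_add act_diff)
  next
    assume m: "m + 1 = 2 * k"
    then have "odd m" by presburger
    moreover have "row m (k + 1) = row m (k - 1)"
    proof
      have "m + 1 - (k - 1) = k + 1" using m k' by simp
      then show "row m (k + 1) i = row m (k - 1) i" for i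
        using row_reflect[of "k - 1" m i] m k' by simp
    qed
    \<comment> \<open>Both sides of \<open>step\<close> carry a factor 2, which is cancelled.\<close>
    ultimately show ?thesis
      using step by (simp add: act_add act_diff)
  qed
next
  case (ge2 j)
  let ?P = "act (central_multiplier m (k - 1))"
  define a where "a = k - Suc j"
  have a: "1 \<le> a" "a \<le> m" "k - Suc (Suc j) = a - 1" "k - j = a + 1"
    using ge2(3) k by (auto simp: a_def)
  have IH1: "act (multiplier m (Suc j)) I = (\<lambda>i. 2 * ?P (row m a) i)"
    using ge2 by (simp add: fun_eq_iff a_def)
  have IH0: "act (multiplier m j) I n = 2 * ?P (row m (a + 1)) n"
    using ge2 a by simp
  have "act (multiplier m (Suc (Suc j))) I n
      = difference (act (multiplier m (Suc j)) I) n - act (multiplier m j) I n"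
    by (simp only: multiplier.simps act_diff act_mult act_Delta)
  also have "\<dots> = 2 * ?P (difference (row m a)) n - 2 * ?P (row m (a + 1)) n"
    by (simp only: IH1 IH0 difference_cmult act_difference)
  also have "\<dots> = 2 * ?P (row m (a - 1)) n"
    using a by (simp add: difference_row act_plus_right)
  finally show ?case by (simp only: a)
qed

theorem corollary3p10:
  fixes m k a n :: nat
  assumes "m \<ge> 1"
    and "k = nat \<lceil>real m / 2\<rceil>"
    and "a \<in> {1..k}"
    and "n \<ge> 1"
  shows "act (multiplier m (k - a)) (column_sum m) n =
    act (2 * (multiplier' (int k - 1) + (multiplier m 0 - 1) * multiplier' (int k - 2)))
      (\<lambda>j. cell_count m j a) n"
proof -
  have k: "m = 2 * k \<or> m + 1 = 2 * k"
  proof (cases "even m")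
    case True
    then obtain l where "m = 2 * l" ..
    with assms(2) show ?thesis by simp
  next
    case False
    then obtain l where l: "m = 2 * l + 1" by (rule oddE)
    then have "\<lceil>real m / 2\<rceil> = int l + 1"
      by (intro ceiling_unique) (simp_all add: field_simps)
    with assms(2) have "k = nat (int l + 1)" by (simp only:)
    with l show ?thesis by (simp add: nat_add_distrib)
  qed
  obtain n' where n': "n = Suc n'"
    using assms(4) by (cases n) auto
  have ka: "k - a < k" "k - (k - a) = a" and P: "central_multiplier m (k - 1)
      = multiplier' (int k - 1) + (multiplier m 0 - 1) * multiplier' (int k - 2)"
    using assms(3) by (auto simp: central_multiplier_def of_nat_diff)
  have "act (multiplier m (k - a)) (column_sum m) n
      = 2 * act (central_multiplier m (k - 1)) (row m a) n'"
    using act_multiplier_column_sum[OF k ka(1), of n'] by (simp only: n' act_Suc_shift ka(2))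
  also have "\<dots> = act (2 * central_multiplier m (k - 1)) (\<lambda>j. cell_count m j a) n"
    unfolding n' act_Suc_shift by (simp add: act_mult row_def[abs_def])
  finally show ?thesis by (simp only: P)
qed

end
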